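(* Let $H\in\mathbb{C}^{M\times M}$ be Hermitian and let $V\in\mathbb{C}^{M\times m}$ be a fixed (time-independent) matrix of full column rank. Put $S=V^\dagger V$, $H_K=V^\dagger HV$, $P_V=VS^{-1}V^\dagger$. For $c,\dot c\in\mathbb{C}^m$ let $$\mathcal J(\dot c;c)=\lVert V\dot c+iHVc\rVert_2^2 .$$ Then for every $c\in\mathbb{C}^m$ the functional $\dot c\mapsto\mathcal J(\dot c;c)$ on $\mathbb{C}^m$ has a unique minimizer, and this minimizer satisfies $$iS\dot c=H_Kc .$$ Equivalently, for the reduced trajectory $\Psi_m(t)=Vc(t)$ (with $c$ a differentiable $\mathbb{C}^m$-valued function of $t$), the equation $iS\dot c=H_Kc$ holds if and only if $$i\dot\Psi_m=P_VH\Psi_m ,$$ and in that case the residual obeys the Galerkin orthogonality condition $$V^\dagger(\dot\Psi_m+iH\Psi_m)=0 .$$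
   Context: $\lVert\cdot\rVert_2$ is the Euclidean norm and $\dagger$ the conjugate transpose. Since $V$ has full column rank, $S$ is Hermitian positive definite and $P_V$ is the orthogonal projector onto the range of $V$. In the minimization, $\dot c$ is treated as a free vector in $\mathbb{C}^m$ with $c$ held fixed; in the trajectory equations, the dot denotes the time derivative. *)

theory Defs
  imports "HOL-Analysis.Analysis"
begin

definition conj_transpose :: "complex^'n^'m \<Rightarrow> complex^'m^'n"  ("_\<^sup>\<dagger>" [1000] 999)
  where "A\<^sup>\<dagger> = (\<chi> i j. cnj (A $ j $ i))"

definition hermitian :: "complex^'n^'n \<Rightarrow> bool"
  where "hermitian A \<longleftrightarrow> A\<^sup>\<dagger> = A"

definition full_column_rank :: "complex^'m^'n \<Rightarrow> bool"
  where "full_column_rank V \<longleftrightarrow> rank V = CARD('m)"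

definition overlap_matrix :: "complex^'m^'n \<Rightarrow> complex^'m^'m"
  where "overlap_matrix V = V\<^sup>\<dagger> ** V"

definition reduced_hamiltonian :: "complex^'n^'n \<Rightarrow> complex^'m^'n \<Rightarrow> complex^'m^'m"
  where "reduced_hamiltonian H V = V\<^sup>\<dagger> ** H ** V"

(* matrix_inv is an unspecified matrix on singular arguments; the overlap matrix is
   invertible exactly when V has full column rank. *)
definition range_projector :: "complex^'m^'n \<Rightarrow> complex^'n^'n"
  where "range_projector V = V ** matrix_inv (overlap_matrix V) ** V\<^sup>\<dagger>"

(* The norm of complex^'n is the Euclidean norm. The argument d is the free vector
   that takes the place of the time derivative of c. *)
definition residual_functional ::
    "complex^'n^'n \<Rightarrow> complex^'m^'n \<Rightarrow> complex^'m \<Rightarrow> complex^'m \<Rightarrow> real"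
  where "residual_functional H V c d = (norm (V *v d + \<i> *s (H *v (V *v c))))\<^sup>2"

end

theory Submission
  imports Defs
begin

text \<open>The real inner product on \<open>complex^'n\<close> is the real part of the Hermitian one, and
  \<open>V\<^sup>\<dagger>\<close> is still the adjoint of \<open>V\<close> for it. The equation
  \<open>i S d = H\<^sub>K c\<close> says that the residual is orthogonal to the range of \<open>V\<close>, so Pythagoras
  gives \<open>J d = J e + \<parallel>V (d - e)\<parallel>\<^sup>2\<close> for a solution \<open>e\<close>, and injectivity of \<open>V\<close> makes
  \<open>e\<close> the only minimizer.\<close>

lemma inner_matrix_vector_mult:
  fixes A :: "complex^'n^'m"
  shows "(A *v x) \<bullet> y = x \<bullet> (A\<^sup>\<dagger> *v y)"
proof -
  have "(A *v x) \<bullet> y = (\<Sum>i\<in>UNIV. \<Sum>j\<in>UNIV. (A $ i $ j * x $ j) \<bullet> (y $ i))"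
    by (simp add: inner_vec_def matrix_vector_mult_def inner_sum_left)
  also have "\<dots> = (\<Sum>j\<in>UNIV. \<Sum>i\<in>UNIV. (A $ i $ j * x $ j) \<bullet> (y $ i))"
    by (rule sum.swap)
  \<comment> \<open>On the real plane of complex numbers, the adjoint of multiplication by
    \<open>a\<close> is multiplication by \<open>cnj a\<close>.\<close>
  also have "\<dots> = (\<Sum>j\<in>UNIV. \<Sum>i\<in>UNIV. x $ j \<bullet> (cnj (A $ i $ j) * y $ i))"
    by (simp add: inner_complex_def algebra_simps)
  also have "\<dots> = x \<bullet> (A\<^sup>\<dagger> *v y)"
    by (simp add: inner_vec_def matrix_vector_mult_def conj_transpose_def inner_sum_right)
  finally show ?thesis .
qed

text \<open>\<open>rank\<close> is the dimension of the row span, so full rank makes the rows span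
  everything; this yields a left inverse and hence a trivial kernel.\<close>

lemma full_column_rank_eq_0_iff:
  fixes V :: "complex^'m^'n"
  assumes "full_column_rank V"
  shows "V *v x = 0 \<longleftrightarrow> x = 0"
proof -
  have "vec.span (rows V) = UNIV"
    using assms unfolding full_column_rank_def row_rank_def_gen
    by (simp add: card_cart_basis vec.dimension_def flip: vec.dim_eq_full)
  then have "\<exists>B. B ** V = mat 1"
    by (simp add: matrix_left_invertible_span_rows_gen)
  then show ?thesis
    by (auto simp: matrix_left_invertible_ker)
qed

text \<open>Pairing \<open>V\<^sup>\<dagger> *v (V *v x)\<close> with \<open>x\<close> gives the
  squared norm of \<open>V *v x\<close>.\<close>

lemma conj_transpose_mult_eq_0_iff:
  fixes V :: "complex^'m^'n"
  shows "V\<^sup>\<dagger> *v (V *v x) = 0 \<longleftrightarrow> V *v x = 0"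
proof
  assume "V\<^sup>\<dagger> *v (V *v x) = 0"
  then have "(V *v x) \<bullet> (V *v x) = 0"
    by (simp add: inner_matrix_vector_mult)
  then show "V *v x = 0"
    by simp
qed simp

lemma invertible_overlap_matrix:
  fixes V :: "complex^'m^'n"
  assumes "full_column_rank V"
  shows "invertible (overlap_matrix V)"
  unfolding invertible_left_inverse matrix_left_invertible_ker overlap_matrix_def
  by (simp flip: matrix_vector_mul_assoc
      add: conj_transpose_mult_eq_0_iff full_column_rank_eq_0_iff[OF assms])

lemma matrix_inv_mult_vector:
  fixes A :: "'a::field^'n^'n"
  assumes "invertible A"
  shows "A *v (matrix_inv A *v x) = x" "matrix_inv A *v (A *v x) = x"
proof -
  \<comment> \<open>\<open>matrix_inv\<close> is a Hilbert choice among two-sided inverses, so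
    invertibility is what makes the choice meaningful.\<close>
  have "A ** matrix_inv A = mat 1 \<and> matrix_inv A ** A = mat 1"
    unfolding matrix_inv_def using assms by (metis (mono_tags, lifting) invertible_def someI_ex)
  then show "A *v (matrix_inv A *v x) = x" "matrix_inv A *v (A *v x) = x"
    by (simp_all add: matrix_vector_mul_assoc)
qed

text \<open>Applying \<open>V\<^sup>\<dagger>\<close> to the residual gives
  \<open>S d + i H_K c\<close>, and multiplying by \<open>\<i>\<close> turns its vanishing into the
  reduced equation. This one equivalence serves both the Pythagorean identity and the Galerkin
  condition.\<close>

lemma normal_equation_iff:
  fixes V :: "complex^'m^'n"
  shows "\<i> *s (overlap_matrix V *v d) = reduced_hamiltonian H V *v c \<longleftrightarrow>
    V\<^sup>\<dagger> *v (V *v d + \<i> *s (H *v (V *v c))) = 0"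
proof -
  have "\<i> *s a = b \<longleftrightarrow> a + \<i> *s b = 0" for a b :: "complex^'m"
  proof
    assume "\<i> *s a = b"
    then have "b = \<i> *s a" ..
    then show "a + \<i> *s b = 0" by (simp add: vec_eq_iff)
  next
    assume "a + \<i> *s b = 0"
    then have "a = - (\<i> *s b)" by (simp only: eq_neg_iff_add_eq_0)
    then show "\<i> *s a = b" by (simp add: vec_eq_iff)
  qed
  then show ?thesis
    by (simp add: overlap_matrix_def reduced_hamiltonian_def matrix_vector_right_distrib
        vector_scalar_commute flip: matrix_vector_mul_assoc)
qed

lemma residual_functional_pythagoras:
  fixes V :: "complex^'m^'n"
  assumes "\<i> *s (overlap_matrix V *v e) = reduced_hamiltonian H V *v c"
  shows "residual_functional H V c d = residual_functional H V c e + (norm (V *v (d - e)))\<^sup>2"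
proof -
  define r where "r = V *v e + \<i> *s (H *v (V *v c))"
  \<comment> \<open>The cross term: moving \<open>V\<close> across the inner product leaves
    \<open>V\<^sup>\<dagger> *v r\<close>, which is zero.\<close>
  have "(V *v (d - e)) \<bullet> r = 0"
    using assms by (simp add: normal_equation_iff inner_matrix_vector_mult r_def)
  moreover have "V *v d + \<i> *s (H *v (V *v c)) = r + V *v (d - e)"
    by (simp add: r_def matrix_vector_mult_diff_distrib)
  ultimately show ?thesis
    unfolding residual_functional_def r_def[symmetric]
    by (simp add: power2_norm_eq_inner inner_add_left inner_add_right inner_commute)
qed

lemma is_arg_min_residual_functional_iff:
  fixes V :: "complex^'m^'n"
  assumes "full_column_rank V"
    and e: "\<i> *s (overlap_matrix V *v e) = reduced_hamiltonian H V *v c"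
  shows "is_arg_min (residual_functional H V c) (\<lambda>_. True) d \<longleftrightarrow> d = e"
proof
  assume "is_arg_min (residual_functional H V c) (\<lambda>_. True) d"
  then have "residual_functional H V c d \<le> residual_functional H V c e"
    by (simp add: is_arg_min_linorder)
  \<comment> \<open>The excess of \<open>d\<close> over \<open>e\<close> is a square, and here it is
    at most zero.\<close>
  then have "V *v (d - e) = 0"
    by (simp add: residual_functional_pythagoras[OF e, of d])
  then show "d = e"
    by (simp add: full_column_rank_eq_0_iff[OF assms(1)])
next
  assume "d = e"
  then show "is_arg_min (residual_functional H V c) (\<lambda>_. True) d"
    by (simp add: is_arg_min_linorder) (metis residual_functional_pythagoras[OF e] le_add_same_cancel1 zero_le_power2)
qed

lemma ex_normal_equation:
  fixes V :: "complex^'m^'n"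
  assumes "full_column_rank V"
  shows "\<exists>d. \<i> *s (overlap_matrix V *v d) = reduced_hamiltonian H V *v c"
proof
  \<comment> \<open>Solve for \<open>d\<close>, using that the inverse of \<open>\<i>\<close> is
    \<open>- \<i>\<close>.\<close>
  let ?d = "matrix_inv (overlap_matrix V) *v (- \<i> *s (reduced_hamiltonian H V *v c))"
  show "\<i> *s (overlap_matrix V *v ?d) = reduced_hamiltonian H V *v c"
    by (simp add: matrix_inv_mult_vector[OF invertible_overlap_matrix[OF assms]] vec_eq_iff)
qed

text \<open>With \<open>h = H_K c\<close>, the projected right-hand side is \<open>V S^-1 h\<close>.
  Forwards, apply \<open>S^-1\<close> and then \<open>V\<close>; backwards, apply
  \<open>V\<^sup>\<dagger>\<close>, which turns each leading \<open>V\<close> into \<open>S\<close>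
  and so cancels \<open>S^-1\<close>.\<close>

lemma normal_equation_iff_projected:
  fixes V :: "complex^'m^'n"
  assumes "full_column_rank V"
  shows "\<i> *s (overlap_matrix V *v d) = reduced_hamiltonian H V *v c \<longleftrightarrow>
    \<i> *s (V *v d) = range_projector V *v (H *v (V *v c))"
proof -
  define S where "S = overlap_matrix V"
  define h where "h = reduced_hamiltonian H V *v c"
  note inv = matrix_inv_mult_vector[OF invertible_overlap_matrix[OF assms], folded S_def]
  have P: "range_projector V *v (H *v (V *v c)) = V *v (matrix_inv S *v h)"
    by (simp add: range_projector_def S_def h_def reduced_hamiltonian_def flip: matrix_vector_mul_assoc)
  have V: "V\<^sup>\<dagger> *v (V *v x) = S *v x" for x
    by (simp add: S_def overlap_matrix_def matrix_vector_mul_assoc)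
  have "\<i> *s (S *v d) = h \<longleftrightarrow> \<i> *s (V *v d) = V *v (matrix_inv S *v h)"
  proof
    assume "\<i> *s (S *v d) = h"
    then have "matrix_inv S *v h = \<i> *s d"
      by (metis inv(2) vector_scalar_commute)
    then show "\<i> *s (V *v d) = V *v (matrix_inv S *v h)"
      by (simp add: vector_scalar_commute)
  next
    assume "\<i> *s (V *v d) = V *v (matrix_inv S *v h)"
    then show "\<i> *s (S *v d) = h"
      by (metis V inv(1) vector_scalar_commute)
  qed
  then show ?thesis
    by (simp add: P S_def h_def)
qed

theorem theorem1:
  fixes H :: "complex^'n^'n" and V :: "complex^'m^'n"
  assumes "hermitian H"
    and "full_column_rank V"
  shows "(\<forall>c :: complex^'m.
            (\<exists>!d. is_arg_min (residual_functional H V c) (\<lambda>_. True) d) \<and>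
            (\<forall>d. is_arg_min (residual_functional H V c) (\<lambda>_. True) d \<longrightarrow>
                 \<i> *s (overlap_matrix V *v d) = reduced_hamiltonian H V *v c)) \<and>
         (\<forall>(T :: real set) (c :: real \<Rightarrow> complex^'m) \<Psi>.
            is_interval T \<and> (\<exists>a\<in>T. \<exists>b\<in>T. a < b) \<and> c differentiable_on T \<and>
            \<Psi> = (\<lambda>t. V *v c t) \<longrightarrow>
            \<Psi> differentiable_on T \<and>
            (\<forall>t\<in>T.
               (\<i> *s (overlap_matrix V *v vector_derivative c (at t within T))
                  = reduced_hamiltonian H V *v c t \<longleftrightarrow>
                \<i> *s vector_derivative \<Psi> (at t within T)
                  = range_projector V *v (H *v \<Psi> t)) \<and>
               (\<i> *s (overlap_matrix V *v vector_derivative c (at t within T))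
                  = reduced_hamiltonian H V *v c t \<longrightarrow>
                V\<^sup>\<dagger> *v (vector_derivative \<Psi> (at t within T) + \<i> *s (H *v \<Psi> t)) = 0)))"
proof (intro conjI allI impI ballI)
  fix c :: "complex^'m"
  obtain e where e: "\<i> *s (overlap_matrix V *v e) = reduced_hamiltonian H V *v c"
    using ex_normal_equation[OF assms(2)] by blast
  note iff = is_arg_min_residual_functional_iff[OF assms(2) e]
  show "\<exists>!d. is_arg_min (residual_functional H V c) (\<lambda>_. True) d"
    by (simp add: iff)
  show "\<i> *s (overlap_matrix V *v d) = reduced_hamiltonian H V *v c"
    if "is_arg_min (residual_functional H V c) (\<lambda>_. True) d" for d
    using that e by (simp add: iff)
next
  fix T :: "real set" and c :: "real \<Rightarrow> complex^'m" and \<Psi>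
  assume "is_interval T \<and> (\<exists>a\<in>T. \<exists>b\<in>T. a < b) \<and> c differentiable_on T \<and>
    \<Psi> = (\<lambda>t. V *v c t)"
  then have T: "is_interval T" "\<exists>a\<in>T. \<exists>b\<in>T. a < b"
    and c: "c differentiable_on T" and \<Psi>: "\<Psi> = (\<lambda>t. V *v c t)"
    by blast+
  \<comment> \<open>The fixed matrix \<open>V\<close> acts as a bounded linear map, so it commutes
    with differentiation.\<close>
  have \<Psi>_deriv: "(\<Psi> has_vector_derivative V *v vector_derivative c (at t within T)) (at t within T)"
    if "t \<in> T" for t
    unfolding \<Psi>
    using c that by (intro bounded_linear.has_vector_derivative[OF matrix_vector_mul_bounded_linear])
      (simp add: differentiable_on_def flip: vector_derivative_works)
  have deriv: "vector_derivative \<Psi> (at t within T) = V *v vector_derivative c (at t within T)"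
    if "t \<in> T" for t
  proof (rule vector_derivative_within[OF _ \<Psi>_deriv[OF that]])
    \<comment> \<open>An interval with two distinct points has no isolated point. Derivatives within
      \<open>T\<close>, one-sided at endpoints, are therefore unique, and
      \<open>vector_derivative\<close> must pick the one found above.\<close>
    have "t islimpt T"
      using T that by (intro connected_imp_perfect) (auto simp: is_interval_connected)
    then show "at t within T \<noteq> bot"
      by (simp add: trivial_limit_within)
  qed
  show "\<Psi> differentiable_on T"
    unfolding differentiable_on_def
    using \<Psi>_deriv differentiableI_vector by blast
  fix t
  assume t: "t \<in> T"
  show "\<i> *s (overlap_matrix V *v vector_derivative c (at t within T)) = reduced_hamiltonian H V *v c t \<longleftrightarrow>
      \<i> *s vector_derivative \<Psi> (at t within T) = range_projector V *v (H *v \<Psi> t)"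
    \<comment> \<open>The derivative is rewritten first, since unfolding \<open>\<Psi>\<close> would
      destroy the term that \<open>deriv\<close> matches.\<close>
    by (simp only: deriv[OF t]) (simp only: \<Psi> normal_equation_iff_projected[OF assms(2)])
  assume "\<i> *s (overlap_matrix V *v vector_derivative c (at t within T)) = reduced_hamiltonian H V *v c t"
  then show "V\<^sup>\<dagger> *v (vector_derivative \<Psi> (at t within T) + \<i> *s (H *v \<Psi> t)) = 0"
    by (simp only: deriv[OF t]) (simp only: \<Psi> normal_equation_iff)
qed

end
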